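(* Let $A\in\mathbb{R}^{m\times n}$, $b\in\mathbb{R}^m$, $p=2$, and let $\phi:\mathbb{R}_+\to\mathbb{R}_+$ be continuous and nondecreasing with $\phi(0)=0$. Let $L$, $s_i,\rho_i,\Omega_i$ ($i\in\mathbb{N}_L^0$) and $K$, $\Lambda_i$ ($i=-1,0,\dots,K-1$), $t_i,\lambda_i$ ($i\in\mathbb{N}_K^0$) be produced by Iterations 1 and 2 of the context. Let $\lambda_{-1}:=+\infty$, let $S_i:=\{z\ge 0:\phi(z)=\rho_i\}$ for $i\in\mathbb{N}_L^0$, and for $\lambda>0$ let $\Omega(\lambda)$ be the set of all global minimizers of the problem $$\min\{\|x\|_0+\lambda\phi(\|Ax-b\|_2):x\in\mathbb{R}^n\}.\qquad(\ast)_\lambda$$ Then for $k\in\mathbb{N}_K^0$: (i) If $\sharp S_{t_k}=1$, then for any $\lambda\in(\lambda_k,\lambda_{k-1})$, $\sharp\Omega(\lambda)$ is finite and any $x\in\Omega(\lambda)$ is a strict minimizer of problem $(\ast)_\lambda$. (ii) If $k\neq K$ and $\sharp S_j=1$ for all $j\in\Lambda_k\cup\{t_k\}$, then $\sharp\Omega(\lambda_k)$ is finite and any $x\in\Omega(\lambda_k)$ is a strict minimizer of problem $(\ast)_{\lambda_k}$.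
   Context: $\mathbb{R}_+=[0,+\infty)$; $\mathbb{N}_k^0=\{0,1,\dots,k\}$; $\sharp S$ is the cardinality of $S$; $\|x\|_0$ is the number of nonzero components of $x$; $\arg\min$, $\arg\max$ denote the sets of all global minimizers/maximizers. For $x\in\mathbb{R}^d$ and $\delta>0$, $U(x;\delta):=\{x'\in\mathbb{R}^d:\|x-x'\|_2\le\delta\}$. For $g:\mathbb{R}^d\to\mathbb{R}$ and $S\subseteq\mathbb{R}^d$, $\hat x$ is a strict minimizer of $\min\{g(x):x\in S\}$ if there exists $\delta>0$ such that $g(x)>g(\hat x)$ for every $x\in U(\hat x;\delta)\cap S$ with $x\ne\hat x$. Iteration 1 (depending on $A,b,p,\phi$). Set $i=0$ and $\rho_0:=\min\{\phi(\|Ax-b\|_p):x\in\mathbb{R}^n\}$, $s_0:=\min\{\|x\|_0:\phi(\|Ax-b\|_p)=\rho_0,\ x\in\mathbb{R}^n\}$, $\Omega_0:=\arg\min\{\|x\|_0:\phi(\|Ax-b\|_p)=\rho_0,\ x\in\mathbb{R}^n\}$. While $s_i>0$: put $\rho_{i+1}:=\min\{\phi(\|Ax-b\|_p):\|x\|_0\le s_i-1,\ x\in\mathbb{R}^n\}$, $s_{i+1}:=\min\{\|x\|_0:\phi(\|Ax-b\|_p)=\rho_{i+1},\ x\in\mathbb{R}^n\}$, $\Omega_{i+1}:=\arg\min\{\|x\|_0:\phi(\|Ax-b\|_p)=\rho_{i+1},\ x\in\mathbb{R}^n\}$, and replace $i$ by $i+1$. When the loop ends (i.e. $s_i=0$),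 set $L:=i$. (All these minima are attained and the iteration terminates.) Iteration 2. Set $i=0$ and $\Lambda_{-1}:=\{0\}$. While $L\notin\Lambda_{i-1}$: put $t_i:=\max\Lambda_{i-1}$, $\lambda_i:=\max\{\frac{s_{t_i}-s_j}{\rho_j-\rho_{t_i}}:j=t_i+1,\dots,L\}$, $\Lambda_i:=\arg\max\{\frac{s_{t_i}-s_j}{\rho_j-\rho_{t_i}}:j=t_i+1,\dots,L\}$ (a set of indices $j$), and replace $i$ by $i+1$. When the loop ends, set $K:=i$, $t_K:=L$, $\lambda_K:=0$. *)

theory Defs
  imports "HOL-Analysis.Analysis"
begin

definition l0norm :: "real ^ 'n \<Rightarrow> nat" where
  "l0norm x = card {i. x $ i \<noteq> 0}"

definition strict_minimizer ::
    "('a::metric_space \<Rightarrow> real) \<Rightarrow> 'a set \<Rightarrow> 'a \<Rightarrow> bool" where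
  "strict_minimizer g S x0 \<longleftrightarrow>
     (\<exists>\<delta>>0. \<forall>x \<in> cball x0 \<delta> \<inter> S. x \<noteq> x0 \<longrightarrow> g x > g x0)"

(* The attained minimum of f on S; unspecified if the minimum is not attained.
   No infimum is substituted for it. *)
definition min_val :: "('a \<Rightarrow> 'b::linorder) \<Rightarrow> 'a set \<Rightarrow> 'b" where
  "min_val f S = (LEAST v. v \<in> f ` S)"

definition fidelity ::
    "real ^ 'n ^ 'm \<Rightarrow> real ^ 'm \<Rightarrow> (real \<Rightarrow> real) \<Rightarrow> real ^ 'n \<Rightarrow> real" where
  "fidelity A b \<phi> x = \<phi> (norm (A *v x - b))"

definition objective ::
    "real ^ 'n ^ 'm \<Rightarrow> real ^ 'm \<Rightarrow> (real \<Rightarrow> real) \<Rightarrow> real \<Rightarrow> real ^ 'n \<Rightarrow> real" where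
  "objective A b \<phi> lam x = real (l0norm x) + lam * fidelity A b \<phi> x"

definition Omega_opt ::
    "real ^ 'n ^ 'm \<Rightarrow> real ^ 'm \<Rightarrow> (real \<Rightarrow> real) \<Rightarrow> real \<Rightarrow> (real ^ 'n) set" where
  "Omega_opt A b \<phi> lam = {x. is_arg_min (objective A b \<phi> lam) (\<lambda>_. True) x}"

(* First iteration.  The sequences are defined for all indices, but the loop produces
   only those up to iter_L; for i < iter_L we have iter_s i > 0, so the subtraction
   on nat is a genuine one there.  Values beyond iter_L are meaningless and unused. *)
fun iter_rho :: "real ^ 'n ^ 'm \<Rightarrow> real ^ 'm \<Rightarrow> (real \<Rightarrow> real) \<Rightarrow> nat \<Rightarrow> real"
  and iter_s :: "real ^ 'n ^ 'm \<Rightarrow> real ^ 'm \<Rightarrow> (real \<Rightarrow> real) \<Rightarrow> nat \<Rightarrow> nat" where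
  "iter_rho A b \<phi> 0 = min_val (fidelity A b \<phi>) UNIV"
| "iter_rho A b \<phi> (Suc i) = min_val (fidelity A b \<phi>) {x. l0norm x \<le> iter_s A b \<phi> i - 1}"
| "iter_s A b \<phi> i = min_val l0norm {x. fidelity A b \<phi> x = iter_rho A b \<phi> i}"

definition iter_Omega ::
    "real ^ 'n ^ 'm \<Rightarrow> real ^ 'm \<Rightarrow> (real \<Rightarrow> real) \<Rightarrow> nat \<Rightarrow> (real ^ 'n) set" where
  "iter_Omega A b \<phi> i =
     {x. is_arg_min l0norm (\<lambda>x. fidelity A b \<phi> x = iter_rho A b \<phi> i) x}"

definition iter_L :: "real ^ 'n ^ 'm \<Rightarrow> real ^ 'm \<Rightarrow> (real \<Rightarrow> real) \<Rightarrow> nat" where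
  "iter_L A b \<phi> = (LEAST i. iter_s A b \<phi> i = 0)"

definition iter_S :: "real ^ 'n ^ 'm \<Rightarrow> real ^ 'm \<Rightarrow> (real \<Rightarrow> real) \<Rightarrow> nat \<Rightarrow> real set" where
  "iter_S A b \<phi> i = {z. z \<ge> 0 \<and> \<phi> z = iter_rho A b \<phi> i}"

definition slope ::
    "real ^ 'n ^ 'm \<Rightarrow> real ^ 'm \<Rightarrow> (real \<Rightarrow> real) \<Rightarrow> nat \<Rightarrow> nat \<Rightarrow> real" where
  "slope A b \<phi> t j =
     (real (iter_s A b \<phi> t) - real (iter_s A b \<phi> j)) / (iter_rho A b \<phi> j - iter_rho A b \<phi> t)"

(* Second iteration.  Its index sets start at -1, so they are shifted by one:
   iter_Lambda_prev i is the set with index i - 1, and iter_Lambda i the one with index i.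
   Entries for which the loop is no longer executed are meaningless and unused. *)
primrec iter_Lambda_prev ::
    "real ^ 'n ^ 'm \<Rightarrow> real ^ 'm \<Rightarrow> (real \<Rightarrow> real) \<Rightarrow> nat \<Rightarrow> nat set" where
  "iter_Lambda_prev A b \<phi> 0 = {0}"
| "iter_Lambda_prev A b \<phi> (Suc i) =
     (let t = Max (iter_Lambda_prev A b \<phi> i)
      in {j. is_arg_max (slope A b \<phi> t) (\<lambda>j. j \<in> {t + 1..iter_L A b \<phi>}) j})"

definition iter_Lambda ::
    "real ^ 'n ^ 'm \<Rightarrow> real ^ 'm \<Rightarrow> (real \<Rightarrow> real) \<Rightarrow> nat \<Rightarrow> nat set" where
  "iter_Lambda A b \<phi> i = iter_Lambda_prev A b \<phi> (Suc i)"

definition iter_K :: "real ^ 'n ^ 'm \<Rightarrow> real ^ 'm \<Rightarrow> (real \<Rightarrow> real) \<Rightarrow> nat" where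
  "iter_K A b \<phi> = (LEAST i. iter_L A b \<phi> \<in> iter_Lambda_prev A b \<phi> i)"

definition iter_t :: "real ^ 'n ^ 'm \<Rightarrow> real ^ 'm \<Rightarrow> (real \<Rightarrow> real) \<Rightarrow> nat \<Rightarrow> nat" where
  "iter_t A b \<phi> i =
     (if i = iter_K A b \<phi> then iter_L A b \<phi> else Max (iter_Lambda_prev A b \<phi> i))"

definition iter_lambda :: "real ^ 'n ^ 'm \<Rightarrow> real ^ 'm \<Rightarrow> (real \<Rightarrow> real) \<Rightarrow> nat \<Rightarrow> real" where
  "iter_lambda A b \<phi> i =
     (if i = iter_K A b \<phi> then 0
      else Max (slope A b \<phi> (iter_t A b \<phi> i) ` {iter_t A b \<phi> i + 1..iter_L A b \<phi>}))"

(* The threshold with index i - 1; the one with index -1 is plus infinity. *)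
definition iter_lambda_prev ::
    "real ^ 'n ^ 'm \<Rightarrow> real ^ 'm \<Rightarrow> (real \<Rightarrow> real) \<Rightarrow> nat \<Rightarrow> ereal" where
  "iter_lambda_prev A b \<phi> i = (case i of 0 \<Rightarrow> \<infinity> | Suc j \<Rightarrow> ereal (iter_lambda A b \<phi> j))"

end

theory Submission
  imports Defs
begin

text \<open>Every point is dominated, in both the number of nonzero entries and the fidelity, by some
  pair \<open>(s\<^sub>i, \<rho>\<^sub>i)\<close> with \<open>i \<le> L\<close>. Hence a global minimizer for \<open>\<lambda> > 0\<close> realizes such a pair, with
  \<open>i\<close> minimizing \<open>s\<^sub>i + \<lambda> \<rho>\<^sub>i\<close>; Iteration 2 walks along the lower convex hull of these pairs, so the
  minimizing indices are \<open>t\<^sub>k\<close> alone between two thresholds and lie in \<open>\<Lambda>\<^sub>k \<union> {t\<^sub>k}\<close> at \<open>\<lambda>\<^sub>k\<close>.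
  If \<open>\<phi>\<close> takes the value \<open>\<rho>\<^sub>i\<close> only once, then a minimizer is determined by its support: the midpoint
  of two minimizers with different residuals and the same support would have a smaller residual,
  and two with the same residual would span a line along which a nonzero entry can be cancelled.
  So there are only finitely many minimizers, and finitely many global minimizers are strict.\<close>

section \<open>Finite minimizer sets, sparse least squares and midpoints\<close>

lemma strict_minimizer_of_finite_argmin:
  fixes g :: "'a::metric_space \<Rightarrow> real"
  assumes "finite {x. is_arg_min g (\<lambda>_. True) x}" and "is_arg_min g (\<lambda>_. True) x"
  shows "strict_minimizer g UNIV x"
proof -
  obtain d where d: "d > 0" "\<forall>y\<in>{x. is_arg_min g (\<lambda>_. True) x}. y \<noteq> x \<longrightarrow> d \<le> dist x y"
    using finite_set_avoid[OF assms(1)] by blast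
  \<comment> \<open>Other global minimizers lie at distance at least \<open>d\<close> from
    \<open>x\<close>, so none lies in the closed ball of radius \<open>d/2\<close>.\<close>
  have "g y > g x" if "y \<in> cball x (d/2)" "y \<noteq> x" for y
  proof -
    have "\<not> is_arg_min g (\<lambda>_. True) y"
      using d that by force
    then obtain z where "g z < g y"
      by (auto simp: is_arg_min_def)
    moreover have "g x \<le> g z"
      using assms(2) by (auto simp: is_arg_min_def not_less)
    ultimately show ?thesis by simp
  qed
  then show ?thesis
    unfolding strict_minimizer_def using d(1) by (intro exI[of _ "d/2"]) auto
qed

lemma min_val_eqI:
  assumes "x \<in> S" and "\<And>y. y \<in> S \<Longrightarrow> f x \<le> f y"
  shows "min_val f S = f x"
  unfolding min_val_def using assms by (intro Least_equality) auto

lemma l0norm_mono: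
  assumes "\<And>i. y $ i \<noteq> 0 \<Longrightarrow> x $ i \<noteq> 0"
  shows "l0norm y \<le> l0norm x"
  unfolding l0norm_def using assms by (intro card_mono) auto

lemma l0norm_strict_mono:
  assumes "\<And>i. y $ i \<noteq> 0 \<Longrightarrow> x $ i \<noteq> 0" and "x $ k \<noteq> 0" and "y $ k = 0"
  shows "l0norm y < l0norm x"
  unfolding l0norm_def using assms by (intro psubset_card_mono) auto

text \<open>Sparse vectors form a finite union of coordinate subspaces, so their images under
  \<open>A\<close> form a closed set, which has a point nearest to \<open>b\<close>. Working in the
  image avoids coercivity, which fails when \<open>A\<close> has a kernel.\<close>

lemma residual_attains_min:
  fixes A :: "real ^ 'n ^ 'm"
  obtains x where "l0norm x \<le> r"
    and "\<And>y. l0norm y \<le> r \<Longrightarrow> norm (A *v x - b) \<le> norm (A *v y - b)"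
proof -
  let ?V = "\<lambda>\<sigma>::'n set. {x::real^'n. \<forall>i. i \<notin> \<sigma> \<longrightarrow> x $ i = 0}"
  have "{x::real^'n. l0norm x \<le> r} = (\<Union>\<sigma>\<in>{\<sigma>. card \<sigma> \<le> r}. ?V \<sigma>)"
  proof (intro set_eqI iffI)
    fix x :: "real^'n" assume "x \<in> {x. l0norm x \<le> r}"
    then have "card {i. x $ i \<noteq> 0} \<le> r" and "x \<in> ?V {i. x $ i \<noteq> 0}"
      by (auto simp: l0norm_def)
    then show "x \<in> (\<Union>\<sigma>\<in>{\<sigma>. card \<sigma> \<le> r}. ?V \<sigma>)" by blast
  next
    fix x assume "x \<in> (\<Union>\<sigma>\<in>{\<sigma>. card \<sigma> \<le> r}. ?V \<sigma>)"
    then obtain \<sigma> where "card \<sigma> \<le> r" "x \<in> ?V \<sigma>" by blast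
    moreover from this have "card {i. x $ i \<noteq> 0} \<le> card \<sigma>"
      by (intro card_mono) auto
    ultimately show "x \<in> {x. l0norm x \<le> r}" by (simp add: l0norm_def)
  qed
  moreover have "closed ((*v) A ` ?V \<sigma>)" for \<sigma>
  proof -
    have "subspace (?V \<sigma>)" by (auto simp: subspace_def)
    then show ?thesis
      by (intro closed_subspace linear_subspace_image matrix_vector_mul_linear)
  qed
  ultimately have "closed ((*v) A ` {x. l0norm x \<le> r})"
    by (auto simp: image_UN intro!: closed_UN)
  moreover have "(*v) A ` {x. l0norm x \<le> r} \<noteq> {}"
    by (auto simp: l0norm_def intro: exI[of _ 0])
  ultimately obtain v where v: "v \<in> (*v) A ` {x. l0norm x \<le> r}"
    "\<And>w. w \<in> (*v) A ` {x. l0norm x \<le> r} \<Longrightarrow> dist b v \<le> dist b w"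
    by (rule distance_attains_inf[of _ b]) iprover
  from v(1) obtain x where "l0norm x \<le> r" "v = A *v x" by blast
  then show thesis
    using v(2) by (intro that[of x]) (auto simp: dist_norm norm_minus_commute[of _ b])
qed

text \<open>Strict convexity of the Euclidean norm: equality in the triangle inequality makes
  \<open>u\<close> and \<open>v\<close> parallel, and equal norms then make them equal.\<close>

lemma norm_midpoint_less:
  fixes u v :: "'a::real_inner"
  assumes "norm u = norm v" and "u \<noteq> v"
  shows "norm ((1/2) *\<^sub>R (u + v)) < norm u"
proof -
  have "norm (u + v) \<noteq> norm u + norm v"
  proof
    assume "norm (u + v) = norm u + norm v"
    then have "norm u *\<^sub>R v = norm v *\<^sub>R u"
      using norm_triangle_eq by metis
    then show False using assms by auto
  qed
  then show ?thesis
    using norm_triangle_ineq[of u v] assms(1) by simp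
qed

section \<open>Iteration 1: attained minima, strict monotonicity and termination\<close>

locale monotone_fidelity =
  fixes A :: "real ^ 'n ^ 'm" and b :: "real ^ 'm" and \<phi> :: "real \<Rightarrow> real"
  assumes mono: "mono_on {0..} \<phi>"
begin

abbreviation "f \<equiv> fidelity A b \<phi>"
abbreviation "\<rho> \<equiv> iter_rho A b \<phi>"
abbreviation "s \<equiv> iter_s A b \<phi>"
abbreviation "L \<equiv> iter_L A b \<phi>"
abbreviation "sl \<equiv> slope A b \<phi>"
abbreviation "Lp \<equiv> iter_Lambda_prev A b \<phi>"
abbreviation "K \<equiv> iter_K A b \<phi>"
abbreviation "t \<equiv> iter_t A b \<phi>"
abbreviation "\<theta> \<equiv> iter_lambda A b \<phi>"

declare iter_rho.simps [simp del] iter_s.simps [simp del] iter_Lambda_prev.simps(2) [simp del]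

lemma fidelity_mono: "norm (A *v x - b) \<le> norm (A *v y - b) \<Longrightarrow> f x \<le> f y"
  unfolding fidelity_def using mono by (auto simp: mono_on_def)

lemma fidelity_min_val:
  obtains x where "l0norm x \<le> r" and "f x = min_val f {x. l0norm x \<le> r}"
    and "\<And>y. l0norm y \<le> r \<Longrightarrow> f x \<le> f y"
proof -
  obtain x where x: "l0norm x \<le> r"
    "\<And>y. l0norm y \<le> r \<Longrightarrow> norm (A *v x - b) \<le> norm (A *v y - b)"
    using residual_attains_min by blast
  then have "f x = min_val f {x. l0norm x \<le> r}"
    by (subst min_val_eqI[of x]) (auto intro: fidelity_mono)
  then show thesis using that x fidelity_mono by blast
qed

text \<open>\<open>sparsity_bound i\<close> is the sparsity constraint under which \<open>\<rho>\<^sub>i\<close> is the optimal value.\<close>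

definition sparsity_bound :: "nat \<Rightarrow> nat" where
  "sparsity_bound i = (case i of 0 \<Rightarrow> CARD('n) | Suc j \<Rightarrow> s j - 1)"

lemma l0norm_le_card: "l0norm (x :: real^'n) \<le> CARD('n)"
  unfolding l0norm_def by (intro card_mono) auto

text \<open>The vacuous bound \<open>CARD('n)\<close> at index 0 merges the two equations of
  Iteration 1, so that \<open>rho_le\<close> and \<open>s_le_sparsity_bound\<close> hold uniformly
  in the index.\<close>

lemma rho_eq: "\<rho> i = min_val f {x. l0norm x \<le> sparsity_bound i}"
proof (cases i)
  case 0
  have "{x::real^'n. l0norm x \<le> CARD('n)} = UNIV" using l0norm_le_card by auto
  then show ?thesis using 0 by (simp add: iter_rho.simps sparsity_bound_def)
qed (simp add: iter_rho.simps sparsity_bound_def)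

lemma rho_le: "l0norm x \<le> sparsity_bound i \<Longrightarrow> \<rho> i \<le> f x"
  unfolding rho_eq by (metis fidelity_min_val)

lemma s_le: "f x = \<rho> i \<Longrightarrow> s i \<le> l0norm x"
  unfolding iter_s.simps min_val_def by (rule Least_le) auto

lemma pair_attained: obtains x where "f x = \<rho> i" and "l0norm x = s i"
proof -
  obtain y where "f y = \<rho> i" unfolding rho_eq by (metis fidelity_min_val)
  then have "l0norm y \<in> l0norm ` {x. f x = \<rho> i}" by blast
  then have "s i \<in> l0norm ` {x. f x = \<rho> i}"
    unfolding iter_s.simps min_val_def by (rule LeastI)
  then show thesis using that by auto
qed

lemma s_le_sparsity_bound: "s i \<le> sparsity_bound i"
  unfolding rho_eq by (metis fidelity_min_val le_trans rho_eq s_le)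

text \<open>Positivity makes the truncated subtraction in \<open>sparsity_bound (Suc i)\<close>
  genuine.\<close>

lemma s_Suc_less: "s i > 0 \<Longrightarrow> s (Suc i) < s i"
  using s_le_sparsity_bound[of "Suc i"] by (simp add: sparsity_bound_def)

text \<open>A point realizing the next pair has fewer than \<open>s i\<close> nonzero entries. It is
  therefore feasible for the problem defining \<open>\<rho> i\<close>, and attaining
  \<open>\<rho> i\<close> would contradict the minimality of \<open>s i\<close>.\<close>

lemma rho_Suc_less:
  assumes "s i > 0" shows "\<rho> i < \<rho> (Suc i)"
proof -
  obtain x where x: "f x = \<rho> (Suc i)" "l0norm x = s (Suc i)"
    using pair_attained by blast
  have less: "l0norm x < s i" using x s_Suc_less[OF assms] by simp
  then have "\<rho> i \<le> f x" using s_le_sparsity_bound[of i] by (intro rho_le) simp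
  moreover have "f x \<noteq> \<rho> i" using s_le less leD by blast
  ultimately show ?thesis using x by simp
qed

lemma ex_s_eq_0: "\<exists>i. s i = 0"
proof (rule ccontr)
  assume "\<not> ?thesis"
  then have "s i + i \<le> s 0" for i
  proof (induction i)
    case (Suc i)
    then show ?case using s_Suc_less[of i] by fastforce
  qed simp
  from this[of "Suc (s 0)"] show False by simp
qed

lemma s_L: "s L = 0"
  unfolding iter_L_def by (rule LeastI_ex[OF ex_s_eq_0])

lemma s_pos: "i < L \<Longrightarrow> s i > 0"
  unfolding iter_L_def using not_less_Least by blast

lemma s_rho_strict:
  assumes "i < j" "j \<le> L" shows "s j < s i \<and> \<rho> i < \<rho> j"
  using assms
proof (induction j)
  case (Suc j)
  then have "s (Suc j) < s j" "\<rho> j < \<rho> (Suc j)"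
    using s_Suc_less rho_Suc_less s_pos by auto
  then show ?case using Suc by (cases "i = j") auto
qed simp

section \<open>Global minimizers realize pairs of Iteration 1\<close>

lemma dominated:
  obtains i where "i \<le> L" and "s i \<le> l0norm x" and "\<rho> i \<le> f x"
proof -
  \<comment> \<open>For the first such index the preceding one fails, so \<open>l0norm x\<close> is
    at most the preceding \<open>s\<close> minus 1 and \<open>x\<close> competes in the problem
    defining \<open>\<rho> i\<close>.\<close>
  define i where "i = (LEAST i. s i \<le> l0norm x)"
  have L: "s L \<le> l0norm x" by (simp add: s_L)
  have i: "s i \<le> l0norm x" "i \<le> L"
    unfolding i_def using L by (rule LeastI, rule Least_le)
  have "l0norm x \<le> sparsity_bound i"
  proof (cases i)
    case 0
    then show ?thesis by (simp add: sparsity_bound_def l0norm_le_card)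
  next
    case (Suc j)
    then have "\<not> s j \<le> l0norm x" unfolding i_def by (metis lessI not_less_Least)
    then show ?thesis by (simp add: Suc sparsity_bound_def)
  qed
  then show thesis using that i rho_le by blast
qed

text \<open>Comparing \<open>x\<close> with a point realizing pair \<open>j\<close> bounds its
  objective by \<open>s j + lam * \<rho> j\<close>. Taking for \<open>j\<close> the pair that
  dominates \<open>x\<close> forces equality of the fidelities, since \<open>lam\<close> is
  positive.\<close>

lemma Omega_opt_index:
  assumes "lam > 0" and x: "x \<in> Omega_opt A b \<phi> lam"
  obtains i where "i \<le> L" and "f x = \<rho> i"
    and "\<And>j. s i + lam * \<rho> i \<le> s j + lam * \<rho> j"
proof -
  have opt: "objective A b \<phi> lam x \<le> objective A b \<phi> lam y" for y
    using x by (auto simp: Omega_opt_def is_arg_min_def not_less)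
  obtain i where i: "i \<le> L" "s i \<le> l0norm x" "\<rho> i \<le> f x"
    using dominated by blast
  have le: "l0norm x + lam * f x \<le> s j + lam * \<rho> j" for j
    using opt pair_attained[of j] by (metis objective_def)
  have "lam * f x \<le> lam * \<rho> i" using le[of i] i by simp
  then have "f x = \<rho> i" using i \<open>lam > 0\<close> by simp
  moreover have "s i + lam * \<rho> i \<le> s j + lam * \<rho> j" for j
    using le[of j] i calculation by simp
  ultimately show thesis using that i by blast
qed

section \<open>Iteration 2: slopes, index sets and thresholds\<close>

lemma slope_le_iff:
  assumes "i < j" "j \<le> L"
  shows "sl i j \<le> c \<longleftrightarrow> s i + c * \<rho> i \<le> s j + c * \<rho> j"
    and "sl i j < c \<longleftrightarrow> s i + c * \<rho> i < s j + c * \<rho> j"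
  \<comment> \<open>The denominator of the slope is positive. The slope is thus the weight at which
    pairs \<open>i\<close> and \<open>j\<close> tie, and above it pair \<open>i\<close> is the
    better one.\<close>
  using s_rho_strict[OF assms] unfolding slope_def
  by (auto simp: field_simps)

lemma slope_eq_iff:
  assumes "i < j" "j \<le> L"
  shows "sl i j = c \<longleftrightarrow> s i + c * \<rho> i = s j + c * \<rho> j"
  using slope_le_iff[OF assms, of c] by linarith

lemma slope_pos: "i < j \<Longrightarrow> j \<le> L \<Longrightarrow> 0 < sl i j"
  using s_rho_strict unfolding slope_def by simp

lemma Lambda_Suc:
  assumes "Max (Lp i) < L"
  shows "Lp (Suc i) = {j \<in> {Max (Lp i) + 1..L}.
           sl (Max (Lp i)) j = Max (sl (Max (Lp i)) ` {Max (Lp i) + 1..L})}"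
    and "Lp (Suc i) \<noteq> {}"
proof -
  let ?m = "Max (Lp i)"
  let ?I = "{?m + 1..L}"
  let ?M = "Max (sl ?m ` ?I)"
  have ne: "?I \<noteq> {}" using assms by simp
  have le: "sl ?m j \<le> ?M" if "j \<in> ?I" for j using that by simp
  have M: "?M \<in> sl ?m ` ?I" using ne by (intro Max_in) auto
  show eq: "Lp (Suc i) = {j \<in> ?I. sl ?m j = ?M}"
  proof (intro set_eqI)
    fix j
    have "j \<in> Lp (Suc i) \<longleftrightarrow> j \<in> ?I \<and> (\<forall>y\<in>?I. sl ?m y \<le> sl ?m j)"
      by (auto simp: iter_Lambda_prev.simps(2) is_arg_max_def Let_def not_less)
    also have "\<dots> \<longleftrightarrow> j \<in> ?I \<and> sl ?m j = ?M"
    proof (intro conj_cong refl iffI ballI)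
      assume "j \<in> ?I" and "\<forall>y\<in>?I. sl ?m y \<le> sl ?m j"
      then show "sl ?m j = ?M" using le[of j] M by (intro antisym) auto
    next
      fix y assume "sl ?m j = ?M" and "y \<in> ?I"
      then show "sl ?m y \<le> sl ?m j" using le[of y] by simp
    qed
    finally show "j \<in> Lp (Suc i) \<longleftrightarrow> j \<in> {j \<in> ?I. sl ?m j = ?M}" by simp
  qed
  show "Lp (Suc i) \<noteq> {}" unfolding eq using M by force
qed

text \<open>Each new index set lies strictly above the maximum of the previous one, so the lower
  bound grows with every round; this is what forces termination.\<close>

lemma Lambda_prev_bounds:
  assumes "\<And>j. j < i \<Longrightarrow> L \<notin> Lp j"
  shows "Lp i \<noteq> {} \<and> Lp i \<subseteq> {i..L}"
  using assms
proof (induction i)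
  case (Suc i)
  then have IH: "Lp i \<noteq> {}" "Lp i \<subseteq> {i..L}" and notin: "L \<notin> Lp i" by auto
  have "finite (Lp i)" using IH finite_subset by blast
  then have "Max (Lp i) \<in> Lp i" using IH by simp
  then have "Max (Lp i) < L" "i \<le> Max (Lp i)"
    using IH notin by (auto simp: subset_iff order_le_less)
  then show ?case using Lambda_Suc[of i] by auto
qed simp

lemma L_in_Lambda_K: "L \<in> Lp K"
proof -
  have "\<exists>i. L \<in> Lp i"
  proof (rule ccontr)
    assume "\<not> ?thesis"
    then have "Lp (Suc L) \<noteq> {} \<and> Lp (Suc L) \<subseteq> {Suc L..L}"
      by (intro Lambda_prev_bounds) blast
    then show False by simp
  qed
  then show ?thesis unfolding iter_K_def by (rule LeastI_ex)
qed

lemma L_notin_Lambda: "i < K \<Longrightarrow> L \<notin> Lp i"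
  unfolding iter_K_def by (rule not_less_Least)

lemma Lambda_prev_le_K:
  assumes "i \<le> K"
  shows "finite (Lp i)" and "Lp i \<noteq> {}" and "Lp i \<subseteq> {..L}"
  using Lambda_prev_bounds[of i] L_notin_Lambda assms finite_subset by fastforce+

text \<open>The separate clause at \<open>K\<close> agrees with the maximum, because
  \<open>Lp K\<close> contains \<open>L\<close> and has no larger element.\<close>

lemma t_eq_Max:
  assumes "i \<le> K" shows "t i = Max (Lp i)"
proof -
  have "Max (Lp K) = L"
    using Lambda_prev_le_K[of K] L_in_Lambda_K by (intro Max_eqI) auto
  then show ?thesis by (simp add: iter_t_def)
qed

lemma t_less_L: "i < K \<Longrightarrow> t i < L"
  using Lambda_prev_le_K[of i] L_notin_Lambda[of i] t_eq_Max[of i]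
  by (metis Max_in atMost_iff le_neq_implies_less less_imp_le subsetD)

lemma t_K: "t K = L"
  by (simp add: iter_t_def)

lemma t_0: "t 0 = 0"
  by (subst t_eq_Max) auto

lemma Lambda_iff:
  assumes "i < K"
  shows "j \<in> Lp (Suc i) \<longleftrightarrow> t i < j \<and> j \<le> L \<and> sl (t i) j = \<theta> i"
proof -
  have "t i = Max (Lp i)" using t_eq_Max[of i] assms by simp
  then show ?thesis
    using Lambda_Suc(1)[of i] t_less_L[OF assms] assms
    by (auto simp: iter_lambda_def Suc_le_eq)
qed

lemma slope_le_lambda: "i < K \<Longrightarrow> t i < j \<Longrightarrow> j \<le> L \<Longrightarrow> sl (t i) j \<le> \<theta> i"
  by (simp add: iter_lambda_def)

lemma t_Suc_in_Lambda: "i < K \<Longrightarrow> t (Suc i) \<in> Lp (Suc i)"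
  using t_eq_Max[of "Suc i"] Max_in[OF Lambda_prev_le_K(1,2)[of "Suc i"]] by simp

lemma lambda_pos: "i < K \<Longrightarrow> 0 < \<theta> i"
  using t_Suc_in_Lambda[of i] Lambda_iff[of i "t (Suc i)"] slope_pos[of "t i" "t (Suc i)"] by simp

lemma lambda_nonneg: "i \<le> K \<Longrightarrow> 0 \<le> \<theta> i"
  using lambda_pos[of i] by (cases "i = K") (auto simp: iter_lambda_def)

text \<open>Since \<open>t\<^bsub>i+1\<^esub>\<close> is the largest maximizer of the slope from \<open>t\<^sub>i\<close>, later slopes are strictly smaller.\<close>

lemma lambda_Suc_less:
  assumes "i < K" shows "\<theta> (Suc i) < \<theta> i"
proof (cases "Suc i = K")
  case True
  then show ?thesis using lambda_pos[OF assms] by (simp add: iter_lambda_def)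
next
  case False
  then have Suc: "Suc i < K" using assms by simp
  let ?u = "t (Suc i)" and ?v = "t (Suc (Suc i))"
  have u: "t i < ?u" "?u \<le> L" "sl (t i) ?u = \<theta> i"
    using t_Suc_in_Lambda[OF assms] Lambda_iff[OF assms] by auto
  have v: "?u < ?v" "?v \<le> L" "sl ?u ?v = \<theta> (Suc i)"
    using t_Suc_in_Lambda[OF Suc] Lambda_iff[OF Suc] by auto
  have "?v \<notin> Lp (Suc i)"
    using v(1) t_eq_Max[of "Suc i"] Lambda_prev_le_K(1)[of "Suc i"] Suc
    by (metis Max_ge leD less_imp_le)
  then have "sl (t i) ?v < \<theta> i"
    using Lambda_iff[OF assms, of ?v] slope_le_lambda[OF assms, of ?v] u v by simp
  \<comment> \<open>At weight \<open>\<theta> i\<close> the pairs \<open>t i\<close> and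
    \<open>?u\<close> tie, while \<open>?v\<close> is strictly worse than \<open>t i\<close>, hence
    than \<open>?u\<close>.\<close>
  then have "sl ?u ?v < \<theta> i"
    using slope_le_iff(2)[of "t i" ?v "\<theta> i"] slope_eq_iff[of "t i" ?u "\<theta> i"]
      slope_le_iff(2)[of ?u ?v "\<theta> i"] u v by linarith
  then show ?thesis using v by simp
qed

lemma lambda_less_lambda_prev:
  "i \<le> K \<Longrightarrow> ereal (\<theta> i) < iter_lambda_prev A b \<phi> i"
  using lambda_Suc_less by (auto simp: iter_lambda_prev_def split: nat.split)

section \<open>Minimizing indices between and at the thresholds\<close>

lemma hull_left:
  assumes "i \<le> K" "ereal c < iter_lambda_prev A b \<phi> i" "j < t i"
  shows "s (t i) + c * \<rho> (t i) < s j + c * \<rho> j"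
  using assms
proof (induction i arbitrary: j c)
  case 0
  then show ?case by (simp add: t_0)
next
  case (Suc i)
  then have i: "i < K" by simp
  let ?u = "t (Suc i)" and ?l = "\<theta> i"
  have c: "c < ?l" using Suc.prems by (simp add: iter_lambda_prev_def)
  have u: "t i < ?u" "?u \<le> L" "sl (t i) ?u = ?l"
    using t_Suc_in_Lambda[OF i] Lambda_iff[OF i] by auto
  \<comment> \<open>At the threshold itself, \<open>t i\<close> beats indices to its left by
    induction and is no worse than those to its right by maximality of the slope.\<close>
  have "s (t i) + ?l * \<rho> (t i) \<le> s j + ?l * \<rho> j"
  proof (cases j "t i" rule: linorder_cases)
    case less
    then show ?thesis using Suc.IH[of ?l j] lambda_less_lambda_prev[of i] i by simp
  next
    case greater
    then show ?thesis
      using slope_le_iff(1)[of "t i" j ?l] slope_le_lambda[OF i, of j] Suc.prems u by simp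
  qed simp
  moreover have "s (t i) + ?l * \<rho> (t i) = s ?u + ?l * \<rho> ?u"
    using slope_eq_iff u by blast
  ultimately have "s ?u + ?l * \<rho> ?u \<le> s j + ?l * \<rho> j" by simp
  \<comment> \<open>Lowering the weight from \<open>?l\<close> to \<open>c\<close> lowers the value
    of \<open>?u\<close> by more than that of \<open>j\<close>, since \<open>\<rho> ?u\<close> is
    larger; this makes the inequality strict.\<close>
  moreover have "(?l - c) * \<rho> j < (?l - c) * \<rho> ?u"
    using s_rho_strict[of j ?u] Suc.prems u c by simp
  ultimately show ?case by (simp add: algebra_simps)
qed

lemma hull_index_open:
  assumes "k \<le> K" "\<theta> k < c" "ereal c < iter_lambda_prev A b \<phi> k"
    and "i \<le> L" and min: "\<And>j. s i + c * \<rho> i \<le> s j + c * \<rho> j"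
  shows "i = t k"
proof (cases i "t k" rule: linorder_cases)
  case less
  then show ?thesis using hull_left[OF assms(1,3) less] min[of "t k"] by simp
next
  case greater
  \<comment> \<open>At \<open>k = K\<close> no index up to \<open>L\<close> lies beyond
    \<open>t K\<close>.\<close>
  then have "k < K" using assms t_K by (cases "k = K") auto
  then have "sl (t k) i < c" using slope_le_lambda[of k i] greater assms by simp
  then show ?thesis using slope_le_iff(2)[OF greater assms(4)] min[of "t k"] by simp
qed

lemma hull_index_threshold:
  assumes "k < K" and "i \<le> L"
    and min: "\<And>j. s i + \<theta> k * \<rho> i \<le> s j + \<theta> k * \<rho> j"
  shows "i \<in> iter_Lambda A b \<phi> k \<union> {t k}"
proof (cases i "t k" rule: linorder_cases)
  case less
  then show ?thesis
    using hull_left[OF _ lambda_less_lambda_prev less] min[of "t k"] assms(1) by simp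
next
  case greater
  have "sl (t k) i = \<theta> k"
    using slope_le_iff[OF greater assms(2), of "\<theta> k"] slope_le_lambda[OF assms(1) greater assms(2)]
      min[of "t k"] by linarith
  then have "i \<in> Lp (Suc k)" using Lambda_iff[OF assms(1)] greater assms(2) by blast
  then show ?thesis unfolding iter_Lambda_def by blast
qed simp

section \<open>Finiteness and strictness of the global minimizers\<close>

lemma Omega_opt_support_inj:
  assumes lam: "lam > 0" and x: "x \<in> Omega_opt A b \<phi> lam" and y: "y \<in> Omega_opt A b \<phi> lam"
    and single: "card {z. z \<ge> 0 \<and> \<phi> z = f x} = 1"
    and supp: "{i. x $ i \<noteq> 0} = {i. y $ i \<noteq> 0}"
  shows "x = y"
proof (rule ccontr)
  assume "x \<noteq> y"
  have opt: "objective A b \<phi> lam x \<le> objective A b \<phi> lam w" for w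
    using x by (auto simp: Omega_opt_def is_arg_min_def not_less)
  have "objective A b \<phi> lam x = objective A b \<phi> lam y"
    using x y by (intro antisym) (auto simp: Omega_opt_def is_arg_min_def not_less)
  then have fy: "f y = f x"
    using lam supp by (simp add: objective_def l0norm_def)
  \<comment> \<open>The singleton hypothesis turns equal fidelity into equal residual norm.\<close>
  have unique: "norm (A *v w - b) = norm (A *v x - b)" if "f w = f x" for w
  proof -
    obtain z where "{z. z \<ge> 0 \<and> \<phi> z = f x} = {z}" using single card_1_singletonE by blast
    moreover have "norm (A *v w - b) \<in> {z. z \<ge> 0 \<and> \<phi> z = f x}"
      "norm (A *v x - b) \<in> {z. z \<ge> 0 \<and> \<phi> z = f x}"
      using that by (auto simp: fidelity_def)
    ultimately show ?thesis by simp
  qed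
  show False
  proof (cases "A *v x = A *v y")
    case False
    define w where "w = (1/2) *\<^sub>R (x + y)"
    have "A *v w - b = (1/2) *\<^sub>R ((A *v x - b) + (A *v y - b))"
      unfolding w_def
      by (simp add: matrix_vector_mult_scaleR matrix_vector_right_distrib vec_eq_iff field_simps)
    then have less: "norm (A *v w - b) < norm (A *v x - b)"
      using norm_midpoint_less[of "A *v x - b" "A *v y - b"] unique[OF fy] False by simp
    have "l0norm w \<le> l0norm x"
    proof (rule l0norm_mono)
      fix i assume "w $ i \<noteq> 0"
      then have "x $ i \<noteq> 0 \<or> y $ i \<noteq> 0" by (auto simp: w_def)
      then show "x $ i \<noteq> 0" using supp by auto
    qed
    \<comment> \<open>Optimality of \<open>x\<close> gives one inequality between \<open>f x\<close>
      and \<open>f w\<close>, monotonicity of \<open>\<phi>\<close> the other.\<close>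
    then have "lam * f x \<le> lam * f w" using opt[of w] by (simp add: objective_def)
    then have "f w = f x"
      using lam fidelity_mono[of w x] less by simp
    then show False using unique[of w] less by simp
  next
    case True
    obtain k where k: "x $ k \<noteq> y $ k" using \<open>x \<noteq> y\<close> by (auto simp: vec_eq_iff)
    \<comment> \<open>This \<open>c\<close> makes entry \<open>k\<close> vanish at the point
      \<open>w\<close> of the line through \<open>x\<close> and \<open>y\<close>, on which
      \<open>A\<close> is constant and the support stays inside the common one.\<close>
    define c where "c = x $ k / (x $ k - y $ k)"
    define w where "w = x - c *\<^sub>R (x - y)"
    have "A *v w = A *v x"
      unfolding w_def using True
      by (simp add: matrix_vector_mult_diff_distrib matrix_vector_mult_scaleR)
    then have "f w = f x" by (simp add: fidelity_def)
    moreover have "l0norm w < l0norm x"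
    proof (rule l0norm_strict_mono)
      show "w $ k = 0" using k by (simp add: w_def c_def)
      show "x $ k \<noteq> 0" using k supp by force
      fix i assume "w $ i \<noteq> 0"
      then have "x $ i \<noteq> 0 \<or> y $ i \<noteq> 0" by (auto simp: w_def)
      then show "x $ i \<noteq> 0" using supp by auto
    qed
    ultimately show False using opt[of w] by (simp add: objective_def)
  qed
qed

text \<open>Supports embed the minimizers into the finite power set of the index type.\<close>

lemma Omega_opt_finite_strict:
  assumes "lam > 0"
    and "\<And>x. x \<in> Omega_opt A b \<phi> lam \<Longrightarrow> card {z. z \<ge> 0 \<and> \<phi> z = f x} = 1"
  shows "finite (Omega_opt A b \<phi> lam) \<and>
    (\<forall>x \<in> Omega_opt A b \<phi> lam. strict_minimizer (objective A b \<phi> lam) UNIV x)"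
proof -
  have "inj_on (\<lambda>x. {i. x $ i \<noteq> 0}) (Omega_opt A b \<phi> lam)"
    using Omega_opt_support_inj[OF assms(1)] assms(2) by (intro inj_onI) blast
  then have "finite (Omega_opt A b \<phi> lam)"
    by (rule inj_on_finite[of _ _ UNIV]) auto
  then show ?thesis
    using strict_minimizer_of_finite_argmin by (auto simp: Omega_opt_def)
qed

end

theorem theorem6p8:
  fixes A :: "real ^ 'n ^ 'm" and b :: "real ^ 'm" and \<phi> :: "real \<Rightarrow> real" and k :: nat
  assumes "\<phi> ` {0..} \<subseteq> {0..}"
    and "continuous_on {0..} \<phi>"
    and "mono_on {0..} \<phi>"
    and "\<phi> 0 = 0"
    and "k \<le> iter_K A b \<phi>"
  shows "(card (iter_S A b \<phi> (iter_t A b \<phi> k)) = 1 \<longrightarrow>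
            (\<forall>lam::real. ereal (iter_lambda A b \<phi> k) < ereal lam \<and> ereal lam < iter_lambda_prev A b \<phi> k \<longrightarrow>
               finite (Omega_opt A b \<phi> lam) \<and>
               (\<forall>x \<in> Omega_opt A b \<phi> lam. strict_minimizer (objective A b \<phi> lam) UNIV x)))
       \<and> (k \<noteq> iter_K A b \<phi> \<and>
            (\<forall>j \<in> iter_Lambda A b \<phi> k \<union> {iter_t A b \<phi> k}. card (iter_S A b \<phi> j) = 1) \<longrightarrow>
            finite (Omega_opt A b \<phi> (iter_lambda A b \<phi> k)) \<and>
            (\<forall>x \<in> Omega_opt A b \<phi> (iter_lambda A b \<phi> k).
               strict_minimizer (objective A b \<phi> (iter_lambda A b \<phi> k)) UNIV x))"
proof (intro conjI impI allI)
  interpret monotone_fidelity A b \<phi> by unfold_locales (fact assms(3))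
  {
    fix lam
    assume single: "card (iter_S A b \<phi> (t k)) = 1"
      and lam: "ereal (\<theta> k) < ereal lam \<and> ereal lam < iter_lambda_prev A b \<phi> k"
    \<comment> \<open>For \<open>k = K\<close> the threshold is 0, so positivity comes from the
      strict inequality on \<open>lam\<close>.\<close>
    have pos: "lam > 0" using lam lambda_nonneg[OF assms(5)] by simp
    have "f x = \<rho> (t k)" if "x \<in> Omega_opt A b \<phi> lam" for x
      using Omega_opt_index[OF pos that] hull_index_open[OF assms(5)] lam by (metis less_ereal.simps(1))
    then have "finite (Omega_opt A b \<phi> lam) \<and>
      (\<forall>x \<in> Omega_opt A b \<phi> lam. strict_minimizer (objective A b \<phi> lam) UNIV x)"
      using single by (intro Omega_opt_finite_strict[OF pos]) (simp add: iter_S_def)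
  } note open_case = this
  {
    assume hyp: "k \<noteq> K \<and> (\<forall>j \<in> iter_Lambda A b \<phi> k \<union> {t k}. card (iter_S A b \<phi> j) = 1)"
    then have k: "k < K" using assms(5) by simp
    note pos = lambda_pos[OF k]
    have "\<exists>j \<in> iter_Lambda A b \<phi> k \<union> {t k}. f x = \<rho> j" if "x \<in> Omega_opt A b \<phi> (\<theta> k)" for x
      using Omega_opt_index[OF pos that] hull_index_threshold[OF k] by metis
    then have "finite (Omega_opt A b \<phi> (\<theta> k)) \<and>
      (\<forall>x \<in> Omega_opt A b \<phi> (\<theta> k). strict_minimizer (objective A b \<phi> (\<theta> k)) UNIV x)"
      using hyp by (intro Omega_opt_finite_strict[OF pos]) (metis iter_S_def)
  } note threshold_case = this
  show "finite (Omega_opt A b \<phi> lam)"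
    and "\<forall>x \<in> Omega_opt A b \<phi> lam. strict_minimizer (objective A b \<phi> lam) UNIV x"
    if "card (iter_S A b \<phi> (t k)) = 1"
      and "ereal (\<theta> k) < ereal lam \<and> ereal lam < iter_lambda_prev A b \<phi> k" for lam
    using open_case[OF that] by blast+
  show "finite (Omega_opt A b \<phi> (\<theta> k))"
    and "\<forall>x \<in> Omega_opt A b \<phi> (\<theta> k). strict_minimizer (objective A b \<phi> (\<theta> k)) UNIV x"
    if "k \<noteq> K \<and> (\<forall>j \<in> iter_Lambda A b \<phi> k \<union> {t k}. card (iter_S A b \<phi> j) = 1)"
    using threshold_case[OF that] by blast+
qed

end
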